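(* If $G$ is a vrc-graph with $\gamma_{\rm R}(G)=3$, then $b_{\rm R}(G)\le\Delta(G)+1$.
   Context: Graphs are finite, undirected, without loops or multiple edges; a graph is nonempty if it has at least one edge; $\Delta(G)$ is the maximum degree. A Roman dominating function on $G=(V,E)$ is a function $f:V\to\{0,1,2\}$ such that every vertex $x$ with $f(x)=0$ is adjacent to at least one vertex $y$ with $f(y)=2$. Its weight is $\sum_{u\in V}f(u)$. The Roman domination number $\gamma_{\rm R}(G)$ is the minimum weight of a Roman dominating function on $G$. A graph $G$ of order $n$ is vertex Roman domination-critical (a vrc-graph) if $\gamma_{\rm R}(G)\ne n$ and $\gamma_{\rm R}(G-x)<\gamma_{\rm R}(G)$ for every vertex $x$ of $G$. The Roman bondage number of a nonempty graph $G$ is $b_{\rm R}(G)=\min\{|B|: B\subseteq E(G),\ \gamma_{\rm R}(G-B)>\gamma_{\rm R}(G)\}$, with $b_{\rm R}(G)=\infty$ if no such $B$ exists; here $G-B$ is obtained from $G$ by deleting the edges in $B$ (keeping all vertices). *)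

theory Defs
  imports Main "HOL-Library.Extended_Nat"
begin

text \<open>A graph is given by its vertex set \<open>V\<close> and its edge set \<open>E\<close>, edges being two-element
  subsets of \<open>V\<close>.\<close>

definition finite_simple_graph :: "'a set \<Rightarrow> 'a set set \<Rightarrow> bool" where
  "finite_simple_graph V E \<longleftrightarrow> finite V \<and> (\<forall>e\<in>E. e \<subseteq> V \<and> card e = 2)"

definition adjacent :: "'a set set \<Rightarrow> 'a \<Rightarrow> 'a \<Rightarrow> bool" where
  "adjacent E x y \<longleftrightarrow> {x, y} \<in> E"

definition degree :: "'a set \<Rightarrow> 'a set set \<Rightarrow> 'a \<Rightarrow> nat" where
  "degree V E x = card {y \<in> V. adjacent E x y}"

definition max_degree :: "'a set \<Rightarrow> 'a set set \<Rightarrow> nat" where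
  "max_degree V E = Max (degree V E ` V)"

definition roman_dominating :: "'a set \<Rightarrow> 'a set set \<Rightarrow> ('a \<Rightarrow> nat) \<Rightarrow> bool" where
  "roman_dominating V E f \<longleftrightarrow>
     (\<forall>x\<in>V. f x \<in> {0, 1, 2}) \<and>
     (\<forall>x\<in>V. f x = 0 \<longrightarrow> (\<exists>y\<in>V. adjacent E x y \<and> f y = 2))"

text \<open>The values of \<open>f\<close> outside \<open>V\<close> are unconstrained and do not contribute to the weight.
  The minimum is over a nonempty set of weights, since the constant function 1 is Roman dominating.\<close>

definition roman_domination_number :: "'a set \<Rightarrow> 'a set set \<Rightarrow> nat" where
  "roman_domination_number V E = (LEAST w. \<exists>f. roman_dominating V E f \<and> w = (\<Sum>u\<in>V. f u))"

definition delete_vertex_edges :: "'a set set \<Rightarrow> 'a \<Rightarrow> 'a set set" where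
  "delete_vertex_edges E x = {e \<in> E. x \<notin> e}"

definition vrc_graph :: "'a set \<Rightarrow> 'a set set \<Rightarrow> bool" where
  "vrc_graph V E \<longleftrightarrow>
     finite_simple_graph V E \<and>
     roman_domination_number V E \<noteq> card V \<and>
     (\<forall>x\<in>V. roman_domination_number (V - {x}) (delete_vertex_edges E x)
              < roman_domination_number V E)"

text \<open>The infimum of the empty set in \<^typ>\<open>enat\<close> is \<open>\<infinity>\<close>, which is the value prescribed when
  no set of edges raises the Roman domination number.\<close>

definition roman_bondage_number :: "'a set \<Rightarrow> 'a set set \<Rightarrow> enat" where
  "roman_bondage_number V E =
     (INF B \<in> {B. B \<subseteq> E \<and> roman_domination_number V (E - B) > roman_domination_number V E}.
        enat (card B))"

end

theory Submission
  imports Defs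
begin

text \<open>Deleting a vertex \<open>x\<close> of \<open>G\<close> brings the Roman domination number down from 3 to at most 2.
  As \<open>G\<close> has at least four vertices, an optimal function on \<open>G - x\<close> has to use the value 2, so
  some vertex \<open>y\<close> is adjacent to all vertices except \<open>x\<close> and itself, a \<^emph>\<open>partner\<close> of \<open>x\<close>.
  No vertex is adjacent to all the others, since otherwise the Roman domination number
  of \<open>G\<close> would be at most 2; in particular \<open>x\<close> and \<open>y\<close> are not adjacent.
  (In fact \<open>G\<close> is a complete graph minus a perfect matching.)

  On at least four vertices, a Roman dominating function of weight at most 3 exists only if some
  vertex misses at most one other vertex (lemma \<open>light_roman_dominating_imp_hub\<close>).
  In \<open>G\<close> every vertex already misses some other vertex, so any set \<open>B\<close> of edges that covers all
  vertices raises the Roman domination number.  The edges at \<open>y\<close> cover everything but \<open>x\<close>, and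
  one further edge at \<open>x\<close> completes the cover; there are at most \<open>\<Delta>(G) + 1\<close> of these edges.\<close>

lemma roman_domination_number_le:
  assumes "roman_dominating V E f"
  shows "roman_domination_number V E \<le> (\<Sum>u\<in>V. f u)"
  unfolding roman_domination_number_def using assms by (intro Least_le) blast

lemma roman_domination_number_attained:
  obtains f where "roman_dominating V E f" "roman_domination_number V E = (\<Sum>u\<in>V. f u)"
proof -
  have "roman_dominating V E (\<lambda>_. 1)"
    by (simp add: roman_dominating_def)
  then have "\<exists>w f. roman_dominating V E f \<and> w = (\<Sum>u\<in>V. f u)"
    by blast
  from LeastI_ex[OF this] show thesis
    unfolding roman_domination_number_def[symmetric] using that by blast
qed

lemma roman_domination_number_le_card: "roman_domination_number V E \<le> card V"
  using roman_domination_number_le[of V E "\<lambda>_. 1"] by (simp add: roman_dominating_def)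

lemma adjacent_commute: "adjacent E x y \<longleftrightarrow> adjacent E y x"
  by (simp add: adjacent_def insert_commute)

lemma roman_domination_number_le_2_if_universal:
  assumes "finite V" "u \<in> V" "\<And>v. v \<in> V - {u} \<Longrightarrow> adjacent E u v"
  shows "roman_domination_number V E \<le> 2"
proof -
  let ?f = "\<lambda>v. if v = u then 2 else 0 :: nat"
  have "roman_dominating V E ?f"
    using assms by (auto simp: roman_dominating_def adjacent_commute[of E _ u])
  then have "roman_domination_number V E \<le> (\<Sum>v\<in>V. ?f v)"
    by (rule roman_domination_number_le)
  also have "\<dots> = 2"
    using assms by simp
  finally show ?thesis .
qed

text \<open>A weight below the order forces the value 0 somewhere, hence a vertex \<open>u\<close> with value 2.
  A weight of at most 3 leaves no room for a second such vertex, so \<open>u\<close> alone has to dominate all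
  vertices of value 0, and the remaining weight bounds the number of exceptions.\<close>

lemma light_roman_dominating_imp_hub:
  assumes "finite V" "roman_domination_number V E \<le> 3" "roman_domination_number V E < card V"
  obtains u W where "u \<in> V" "W \<subseteq> V - {u}" "card W + 2 \<le> roman_domination_number V E"
    "\<forall>v\<in>V - {u} - W. adjacent E u v"
proof -
  obtain f where f: "roman_dominating V E f"
    and wt: "roman_domination_number V E = (\<Sum>u\<in>V. f u)"
    by (rule roman_domination_number_attained)
  have "\<exists>x\<in>V. f x = 0"
  proof (rule ccontr)
    assume "\<not> (\<exists>x\<in>V. f x = 0)"
    then have "(\<Sum>u\<in>V. 1) \<le> (\<Sum>u\<in>V. f u)"
      by (intro sum_mono) (auto simp: Suc_le_eq)
    then show False
      using assms wt by simp
  qed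
  then obtain u where u: "u \<in> V" "f u = 2"
    using f by (auto simp: roman_dominating_def)
  define W where "W = {v \<in> V - {u}. f v \<noteq> 0}"
  have rest: "(\<Sum>v\<in>V. f v) = 2 + (\<Sum>v\<in>V - {u}. f v)"
    using u assms(1) by (simp add: sum.remove)
  have unique: "v = u" if "v \<in> V" "f v = 2" for v
  proof (rule ccontr)
    assume "v \<noteq> u"
    then have "f v \<le> (\<Sum>v\<in>V - {u}. f v)"
      using that assms(1) by (intro member_le_sum) auto
    then show False
      using that rest wt assms(2) by simp
  qed
  have "card W = (\<Sum>v\<in>W. 1)"
    by simp
  also have "\<dots> \<le> (\<Sum>v\<in>W. f v)"
    by (rule sum_mono) (auto simp: W_def)
  also have "\<dots> \<le> (\<Sum>v\<in>V - {u}. f v)"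
    using assms(1) by (intro sum_mono2) (auto simp: W_def)
  finally have "card W + 2 \<le> roman_domination_number V E"
    using rest wt by simp
  moreover have "adjacent E u v" if v: "v \<in> V - {u} - W" for v
  proof -
    have "v \<in> V" "f v = 0"
      using v by (auto simp: W_def)
    then obtain z where "z \<in> V" "adjacent E v z" "f z = 2"
      using f by (auto simp: roman_dominating_def)
    then show ?thesis
      using unique adjacent_commute by metis
  qed
  ultimately show thesis
    using that[of u W] u(1) by (auto simp: W_def)
qed

text \<open>In \<open>G - x\<close> the weight is used up by the value 2 alone.\<close>

lemma vertex_deletion_hub:
  assumes "finite V" "x \<in> V" "card V \<ge> 4"
    and "roman_domination_number (V - {x}) (delete_vertex_edges E x) \<le> 2"
  obtains y where "y \<in> V - {x}" "\<forall>v\<in>V - {x, y}. adjacent E y v"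
proof -
  have "finite (V - {x})" "card (V - {x}) \<ge> 3"
    using assms by simp_all
  with assms(4) have "roman_domination_number (V - {x}) (delete_vertex_edges E x) \<le> 3"
      "roman_domination_number (V - {x}) (delete_vertex_edges E x) < card (V - {x})"
    by linarith+
  with \<open>finite (V - {x})\<close> obtain y W where y: "y \<in> V - {x}" "W \<subseteq> V - {x} - {y}"
      "card W + 2 \<le> roman_domination_number (V - {x}) (delete_vertex_edges E x)"
      "\<forall>v\<in>V - {x} - {y} - W. adjacent (delete_vertex_edges E x) y v"
    by (rule light_roman_dominating_imp_hub)
  have "finite W" "card W = 0"
    using y assms by (auto intro: finite_subset)
  then have "W = {}"
    by simp
  then show thesis
    using that[of y] y by (auto simp: adjacent_def delete_vertex_edges_def)
qed

lemma roman_domination_number_ge_4: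
  assumes "finite V" "card V \<ge> 4"
    and missed: "\<And>u. u \<in> V \<Longrightarrow> \<exists>v\<in>V - {u}. \<exists>w\<in>V - {u}. v \<noteq> w \<and> \<not> adjacent E u v \<and> \<not> adjacent E u w"
  shows "roman_domination_number V E \<ge> 4"
proof (rule ccontr)
  assume light: "\<not> ?thesis"
  then have "roman_domination_number V E \<le> 3" "roman_domination_number V E < card V"
    using assms(2) by linarith+
  with assms(1) obtain u W where u: "u \<in> V" "W \<subseteq> V - {u}" "card W + 2 \<le> roman_domination_number V E"
      "\<forall>v\<in>V - {u} - W. adjacent E u v"
    by (rule light_roman_dominating_imp_hub)
  then obtain v w where "v \<noteq> w" "{v, w} \<subseteq> W"
    using missed[of u] by blast
  moreover have "finite W"
    using u assms(1) by (auto intro: finite_subset)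
  ultimately have "2 \<le> card W"
    using card_mono[of W "{v, w}"] by simp
  then show False
    using u(3) light by simp
qed

lemma card_incident_edges_le_max_degree:
  assumes "finite_simple_graph V E" "y \<in> V"
  shows "card {e \<in> E. y \<in> e} \<le> max_degree V E"
proof -
  have fin: "finite V"
    using assms by (simp add: finite_simple_graph_def)
  have "{e \<in> E. y \<in> e} \<subseteq> (\<lambda>v. {y, v}) ` {v \<in> V. adjacent E y v}"
  proof
    fix e assume e: "e \<in> {e \<in> E. y \<in> e}"
    then have "card e = 2" "e \<subseteq> V"
      using assms by (auto simp: finite_simple_graph_def)
    then obtain a b where "e = {a, b}"
      by (auto simp: card_2_iff)
    with e \<open>e \<subseteq> V\<close> show "e \<in> (\<lambda>v. {y, v}) ` {v \<in> V. adjacent E y v}"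
      by (auto simp: adjacent_def image_iff insert_commute)
  qed
  then have "card {e \<in> E. y \<in> e} \<le> degree V E y"
    unfolding degree_def using fin by (intro surj_card_le) auto
  also have "\<dots> \<le> max_degree V E"
    unfolding max_degree_def using fin assms(2) by (intro Max_ge) auto
  finally show ?thesis .
qed

theorem theorem5p8:
  fixes V :: "'a set" and E :: "'a set set"
  assumes "vrc_graph V E"
    and "roman_domination_number V E = 3"
  shows "roman_bondage_number V E \<le> enat (max_degree V E + 1)"
proof -
  have graph: "finite_simple_graph V E" and fin: "finite V"
    using assms(1) by (auto simp: vrc_graph_def finite_simple_graph_def)
  have n: "card V \<ge> 4"
    using assms roman_domination_number_le_card[of V E] by (auto simp: vrc_graph_def)
  have partner: "\<exists>y\<in>V - {x}. \<forall>v\<in>V - {x, y}. adjacent E y v" if "x \<in> V" for x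
  proof -
    have "roman_domination_number (V - {x}) (delete_vertex_edges E x) < 3"
      using assms that by (simp add: vrc_graph_def)
    then have "roman_domination_number (V - {x}) (delete_vertex_edges E x) \<le> 2"
      by linarith
    with fin that n obtain y where "y \<in> V - {x}" "\<forall>v\<in>V - {x, y}. adjacent E y v"
      by (rule vertex_deletion_hub)
    then show ?thesis
      by blast
  qed
  have not_universal: "\<exists>v\<in>V - {u}. \<not> adjacent E u v" if "u \<in> V" for u
  proof (rule ccontr)
    assume "\<not> ?thesis"
    then have "roman_domination_number V E \<le> 2"
      by (intro roman_domination_number_le_2_if_universal[OF fin that]) blast
    then show False
      using assms(2) by simp
  qed
  obtain x where x: "x \<in> V"
    using n by (cases "V = {}") auto
  from partner[OF x] obtain y where y: "y \<in> V" "y \<noteq> x" "\<forall>v\<in>V - {x, y}. adjacent E y v"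
    by blast
  have "\<not> adjacent E y x"
    using not_universal[OF y(1)] y(3) by blast
  have third: "\<exists>v\<in>V. v \<noteq> a \<and> v \<noteq> b \<and> v \<noteq> c" for a b c
  proof -
    have "card {a, b, c} \<le> 3"
      by (simp add: card_insert_if)
    then have "\<not> V \<subseteq> {a, b, c}"
      using n card_mono[of "{a, b, c}" V] by auto
    then show ?thesis
      by blast
  qed
  \<comment> \<open>A neighbour of \<open>x\<close>: a partner \<open>p\<close> of \<open>y\<close> will do, unless \<open>p\<close> is \<open>x\<close> itself, in which case
    \<open>x\<close> is adjacent to everything but \<open>y\<close>.\<close>
  obtain z where z: "z \<in> V" "z \<noteq> x" "adjacent E x z"
  proof -
    obtain p where p: "p \<in> V - {y}" "\<forall>v\<in>V - {y, p}. adjacent E p v"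
      using partner[OF y(1)] by blast
    obtain v where v: "v \<in> V" "v \<noteq> x" "v \<noteq> y"
      using third[of x y y] by blast
    show thesis
    proof (cases "p = x")
      case True
      then show ?thesis
        using p v that[of v] by auto
    next
      case False
      then have "adjacent E p x"
        using p x y(2) by auto
      then show ?thesis
        using False p that[of p] adjacent_commute[of E p x] by auto
    qed
  qed
  have "z \<noteq> y"
    using z(3) \<open>\<not> adjacent E y x\<close> adjacent_commute[of E x y] by auto
  define B where "B = insert {x, z} {e \<in> E. y \<in> e}"
  have "B \<subseteq> E"
    using z by (auto simp: B_def adjacent_def)
  have isolated: "\<not> adjacent (E - B) y v" "\<not> adjacent (E - B) v y" for v
    by (auto simp: B_def adjacent_def)
  have "roman_domination_number V (E - B) \<ge> 4"
  proof (rule roman_domination_number_ge_4[OF fin n])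
    fix u assume u: "u \<in> V"
    consider "u = y" | "u = x" | "u \<noteq> x" "u \<noteq> y"
      by blast
    then show "\<exists>v\<in>V - {u}. \<exists>w\<in>V - {u}. v \<noteq> w \<and> \<not> adjacent (E - B) u v \<and> \<not> adjacent (E - B) u w"
    proof cases
      case 1
      obtain v where "v \<in> V" "v \<noteq> x" "v \<noteq> y"
        using third[of x y y] by blast
      then show ?thesis
        using 1 x y isolated by blast
    next
      case 2
      then have "\<not> adjacent (E - B) u z"
        by (simp add: B_def adjacent_def)
      then show ?thesis
        using 2 y z \<open>z \<noteq> y\<close> isolated by blast
    next
      case 3
      obtain v where v: "v \<in> V - {u}" "\<not> adjacent E u v"
        using not_universal[OF u] by blast
      \<comment> \<open>The edge \<open>uy\<close> was present before the deletion, so \<open>y\<close> is a second missed vertex.\<close>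
      have "adjacent E u y"
        using y(3) u 3 adjacent_commute[of E u y] by blast
      then have "v \<noteq> y"
        using v by blast
      moreover have "\<not> adjacent (E - B) u v"
        using v by (simp add: adjacent_def)
      ultimately show ?thesis
        using v 3 y isolated by blast
    qed
  qed
  then have "roman_bondage_number V E \<le> enat (card B)"
    unfolding roman_bondage_number_def using \<open>B \<subseteq> E\<close> assms(2) by (intro INF_lower) auto
  also have "card B \<le> max_degree V E + 1"
  proof -
    have "card B \<le> card {e \<in> E. y \<in> e} + 1"
      unfolding B_def by (rule card_insert_le_m1) simp_all
    then show ?thesis
      using card_incident_edges_le_max_degree[OF graph y(1)] by linarith
  qed
  finally show ?thesis
    by simp
qed

end
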